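(* For all integers $k \ge 2$ it holds that $$S'_2(k) = \sum_{j=1}^2 S'_2(i_S(k-j)) = S'_2(i_S(k-1)) + S'_2(i_S(k-2)).$$
   Context: The sequence $S'_2 : \mathbb{N}_0 \to \mathbb{N}_0$ (with $\mathbb{N}_0 = \{0,1,2,\dots\}$) is defined recursively: $S'_2(0) := 0$, $S'_2(1) := 2$, and for $k \ge 2$, $S'_2(k) := 2 \cdot (k-i+1)$ for the minimal $i \in \{1,\dots,k-1\}$ with $k-i+1 \le S'_2(i)$ (such an $i$ always exists). For $k \ge 0$ the index is defined by $i_S(k) := k + 1 - \frac{S'_2(k)}{2} \in \mathbb{N} = \{1,2,\dots\}$. *)

theory Defs
  imports Main
begin

(* conj_cong lets the function package see the guard i < k of the recursive call. *)
context
  notes conj_cong [fundef_cong]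
begin

fun S2 :: "nat \<Rightarrow> nat" where
  "S2 k = (if k = 0 then 0 else if k = 1 then 2
           else 2 * (k - (LEAST i. 1 \<le> i \<and> i < k \<and> k - i + 1 \<le> S2 i) + 1))"

end

declare S2.simps [simp del]

lemma S2_0: "S2 0 = 0"
  and S2_1: "S2 1 = 2"
  and S2_rec: "k \<ge> 2 \<Longrightarrow>
    S2 k = 2 * (k - (LEAST i. i \<in> {1..k - 1} \<and> k - i + 1 \<le> S2 i) + 1)"
proof -
  show "S2 0 = 0" "S2 1 = 2"
    by (subst S2.simps, simp)+
  assume k: "k \<ge> 2"
  have "(\<lambda>i. 1 \<le> i \<and> i < k \<and> k - i + 1 \<le> S2 i) =
        (\<lambda>i. i \<in> {1..k - 1} \<and> k - i + 1 \<le> S2 i)"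
    using k by auto
  then show "S2 k = 2 * (k - (LEAST i. i \<in> {1..k - 1} \<and> k - i + 1 \<le> S2 i) + 1)"
    using k by (subst S2.simps) simp
qed

lemma S2_ge_2: "k \<ge> 1 \<Longrightarrow> S2 k \<ge> 2"
  by (cases "k = 1") (use S2_1 S2_rec[of k] in auto)

(* The LEAST in the recursion ranges over a nonempty set. *)
lemma S2_least_exists: "k \<ge> 2 \<Longrightarrow> \<exists>i. i \<in> {1..k - 1} \<and> k - i + 1 \<le> S2 i"
proof (rule exI[of _ "k - 1"])
  assume k: "k \<ge> 2"
  then have "S2 (k - 1) \<ge> 2" by (intro S2_ge_2) linarith
  moreover have "k - (k - 1) + 1 = 2" using k by linarith
  ultimately show "k - 1 \<in> {1..k - 1} \<and> k - (k - 1) + 1 \<le> S2 (k - 1)"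
    using k by simp
qed

lemma even_S2: "even (S2 k)"
  by (cases "k < 2") (use S2_0 S2_1 S2_rec[of k] in \<open>auto simp: less_2_cases_iff\<close>)

lemma S2_half_le: "S2 k div 2 \<le> k"
proof (cases "k < 2")
  case True
  then show ?thesis using S2_0 S2_1 by (auto simp: less_2_cases_iff)
next
  case False
  define i where "i = (LEAST i. i \<in> {1..k - 1} \<and> k - i + 1 \<le> S2 i)"
  have "i \<in> {1..k - 1}"
    using LeastI_ex[OF S2_least_exists[of k]] False unfolding i_def by linarith
  moreover have "S2 k = 2 * (k - i + 1)"
    using S2_rec[of k] False unfolding i_def by linarith
  ultimately show ?thesis by auto
qed

(* Division and subtraction on nat are exact here; see index_S_exact. *)
definition index_S :: "nat \<Rightarrow> nat" where
  "index_S k = k + 1 - S2 k div 2"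

lemma index_S_exact: "2 * index_S k + S2 k = 2 * (k + 1)"
  using S2_half_le[of k] even_S2[of k] unfolding index_S_def by presburger

lemma index_S_pos: "index_S k \<ge> 1"
  using S2_half_le[of k] by (simp add: index_S_def)

end

theory Submission
  imports Defs
begin

text \<open>
  Write \<open>s = S2 / 2\<close>, \<open>m = index_S\<close> and \<open>h i = i + 2 s(i)\<close>. The recursion says that \<open>m k\<close> is the
  least \<open>i\<close> with \<open>k < h i\<close>, so \<open>m\<close> takes the value \<open>i + 1\<close> exactly on the block from \<open>h i\<close> to
  \<open>h (i + 1) - 1\<close>. As \<open>s\<close> grows by 0 or 1 in each step, a block has length 1 or 3 accordingly.
  If \<open>k = h i + r\<close> lies in this block, then \<open>s k = k - i = 2 s(i) + r\<close>, and the block lengths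
  determine \<open>m (k - 1)\<close> and \<open>m (k - 2)\<close>.
\<close>

lemma S2_eq_index: "S2 k = 2 * (k + 1 - index_S k)"
  using index_S_exact[of k] by presburger

lemma index_S_0: "index_S 0 = 1"
  by (simp add: index_S_def S2_0)

lemma index_S_1: "index_S 1 = 1"
  using S2_1 by (simp add: index_S_def)

lemma index_S_le: "k \<ge> 1 \<Longrightarrow> index_S k \<le> k"
  using index_S_exact[of k] S2_ge_2[of k] by simp

lemma index_S_rec:
  assumes "k \<ge> 2"
  shows "index_S k = (LEAST i. i \<in> {1..k - 1} \<and> k - i + 1 \<le> S2 i)" (is "_ = ?l")
proof -
  define l where "l = ?l"
  have "l \<in> {1..k - 1}"
    using LeastI_ex[OF S2_least_exists[OF assms]] unfolding l_def by blast
  moreover have "S2 k = 2 * (k - l + 1)"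
    using S2_rec[OF assms] unfolding l_def .
  ultimately have "index_S k = l"
    using index_S_exact[of k] by auto
  then show ?thesis unfolding l_def .
qed

lemma less_index_S: "k < index_S k + S2 (index_S k)"
proof (cases "k < 2")
  case True
  then have "index_S k = 1"
    using index_S_0 index_S_1 by (auto simp: less_2_cases_iff)
  then show ?thesis using True S2_1 by simp
next
  case False
  then have "k \<ge> 2" by simp
  from LeastI_ex[OF S2_least_exists[OF this], folded index_S_rec[OF this]]
  show ?thesis by auto
qed

text \<open>For \<open>k < 2\<close> or \<open>i \<ge> k\<close> the \<open>LEAST\<close> does not
  apply; there the initial values and \<open>index_S_le\<close> give the bound, as
  \<open>S2 0 = 0\<close> forces \<open>i \<ge> 1\<close>.\<close>

lemma index_S_least:
  assumes "k < i + S2 i"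
  shows "index_S k \<le> i"
proof -
  have i: "i \<ge> 1" using assms S2_0 by (cases i) auto
  show ?thesis
  proof (cases "k \<ge> 2 \<and> i < k")
    case True
    with assms i show ?thesis
      by (subst index_S_rec) (auto intro!: Least_le)
  next
    case False
    with i index_S_0 index_S_1 index_S_le[of k] show ?thesis
      by (cases k) (auto simp: not_le not_less less_2_cases_iff)
  qed
qed

lemma index_S_mono: "k \<le> l \<Longrightarrow> index_S k \<le> index_S l"
  using less_index_S[of l] by (intro index_S_least) linarith

text \<open>One step of \<open>k\<close> raises \<open>2 * index_S k + S2 k\<close> by exactly 2,
  and \<open>index_S\<close> does not decrease.\<close>

lemma S2_Suc_le: "S2 (Suc k) \<le> S2 k + 2"
  using index_S_mono[of k "Suc k"] index_S_exact[of k] index_S_exact[of "Suc k"] by simp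

text \<open>By the same balance it suffices that \<open>index_S\<close> grows by at most 1. This
  needs monotonicity of \<open>S2\<close> only at \<open>index_S k\<close>, which is usually smaller
  than \<open>k\<close>, hence the strong induction.\<close>

lemma S2_le_Suc: "S2 k \<le> S2 (Suc k)"
proof (induction k rule: less_induct)
  case (less k)
  have "Suc k < Suc (index_S k) + S2 (Suc (index_S k))"
  proof (cases "index_S k < k")
    case True
    from less.IH[OF this] less_index_S[of k] show ?thesis by linarith
  next
    case False
    with S2_ge_2[of "Suc (index_S k)"] show ?thesis by simp
  qed
  from index_S_least[OF this] index_S_exact[of k] index_S_exact[of "Suc k"]
  show ?case by simp
qed

lemma S2_mono: "k \<le> l \<Longrightarrow> S2 k \<le> S2 l"
  by (rule lift_Suc_mono_le[of S2, OF S2_le_Suc])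

lemma S2_Suc_cases: "S2 (Suc k) = S2 k \<or> S2 (Suc k) = S2 k + 2"
  using S2_le_Suc[of k] S2_Suc_le[of k] even_S2[of k] even_S2[of "Suc k"] by presburger

text \<open>The first premise excludes \<open>i\<close> itself as an index; monotonicity of
  \<open>S2\<close> excludes all smaller ones.\<close>

lemma index_S_eqI:
  assumes "i + S2 i \<le> k" "k < Suc i + S2 (Suc i)"
  shows "index_S k = Suc i"
proof (rule antisym)
  show "index_S k \<le> Suc i" using assms(2) by (rule index_S_least)
  show "Suc i \<le> index_S k"
  proof (rule ccontr)
    assume "\<not> Suc i \<le> index_S k"
    then have "index_S k \<le> i" by simp
    with S2_mono[OF this] assms(1) less_index_S[of k] show False by linarith
  qed
qed

lemma index_S_block:
  obtains i where "index_S k = Suc i" "i + S2 i \<le> k" "k < Suc i + S2 (Suc i)"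
proof -
  obtain i where i: "index_S k = Suc i"
    using index_S_pos[of k] by (cases "index_S k") auto
  have "i + S2 i \<le> k"
    using index_S_least[of k i] i by (cases "k < i + S2 i") auto
  with i less_index_S[of k] show thesis by (intro that[of i]) auto
qed

lemma S2_eq_sum_index:
  assumes "k \<ge> 2"
  shows "S2 k = S2 (index_S (k - 1)) + S2 (index_S (k - 2))"
proof -
  obtain i where i: "index_S k = Suc i" "i + S2 i \<le> k" "k < Suc i + S2 (Suc i)"
    by (rule index_S_block)
  have Sk: "S2 k = 2 * (k - i)"
    using S2_eq_index[of k] i by simp
  consider "k = i + S2 i" | "k = i + S2 i + 1" "S2 (Suc i) = S2 i + 2"
    | "k = i + S2 i + 2" "S2 (Suc i) = S2 i + 2"
    using i S2_Suc_cases[of i] by linarith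
  then show ?thesis
  proof cases
    case 1
    with assms S2_0 obtain j where j: "i = Suc j" by (cases i) auto
    have a: "index_S (k - 1) = i"
      using 1 j S2_Suc_cases[of j] by (auto intro!: index_S_eqI)
    have b: "S2 (index_S (k - 2)) = S2 i"
    proof (cases "S2 i = S2 j")
      \<comment> \<open>The previous block has length 3, so \<open>k - 2\<close> still lies in
        it.\<close>
      case False
      with 1 j S2_Suc_cases[of j] have "index_S (k - 2) = Suc j"
        by (intro index_S_eqI) auto
      with j show ?thesis by simp
    next
      \<comment> \<open>The previous block is the single point \<open>k - 1\<close>, so
        \<open>k - 2\<close> ends the block before it, whose value \<open>j\<close> has the same
        \<open>S2\<close> as \<open>i\<close>. Here \<open>j \<noteq> 0\<close> because
        \<open>S2 0\<close> and \<open>S2 1\<close> differ.\<close>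
      case True
      with 1 j assms S2_0 S2_1 obtain l where l: "j = Suc l" by (cases j) auto
      have "index_S (k - 2) = Suc l"
        using 1 j l True S2_Suc_cases[of l] by (intro index_S_eqI) auto
      with True l show ?thesis by simp
    qed
    show ?thesis using Sk 1 a b by simp
  next
    \<comment> \<open>Now \<open>k - 1\<close> starts the block of \<open>k\<close>, and
      \<open>k - 2\<close> ends the previous one.\<close>
    case 2
    have a: "index_S (k - 1) = Suc i"
      using 2 by (intro index_S_eqI) auto
    from 2 assms S2_0 obtain j where j: "i = Suc j" by (cases i) auto
    have "index_S (k - 2) = Suc j"
      using 2 j S2_Suc_cases[of j] by (intro index_S_eqI) auto
    with j a Sk 2 show ?thesis by simp
  next
    case 3
    have "index_S (k - 1) = Suc i" "index_S (k - 2) = Suc i"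
      using 3 by (auto intro!: index_S_eqI)
    with Sk 3 show ?thesis by simp
  qed
qed

theorem theorem4p15:
  fixes k :: nat
  assumes "k \<ge> 2"
  shows "S2 k = (\<Sum>j = 1..2. S2 (index_S (k - j))) \<and>
    (\<Sum>j = 1..2. S2 (index_S (k - j))) = S2 (index_S (k - 1)) + S2 (index_S (k - 2))"
proof -
  have "(\<Sum>j = 1..2. S2 (index_S (k - j))) = S2 (index_S (k - 1)) + S2 (index_S (k - 2))"
    by (simp add: numeral_2_eq_2)
  with S2_eq_sum_index[OF assms] show ?thesis by simp
qed

end
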